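(* Let $\alpha\in[0,1]$, let $p$ be a prime, $n$ a positive integer, and $\mathcal G$ an elementary abelian $p$-group of order $p^n$. Put $l=\frac{p^n-1}{p-1}$. Then the $A_\alpha$-spectrum of the power graph $\mathcal P(\mathcal G)$ consists of the eigenvalue $\alpha p-1$ with multiplicity $l(p-2)$ together with the $l+1$ eigenvalues of the $(l+1)\times(l+1)$ matrix whose $(1,1)$ entry is $\alpha l(p-1)$, whose other entries in the first row are all $(1-\alpha)(p-1)$, whose other entries in the first column are all $1-\alpha$, whose other diagonal entries are all $\alpha+p-2$, and all of whose remaining entries are $0$.
   Context: For a simple graph $G$ with adjacency matrix $A(G)$ and diagonal degree matrix $D(G)$, and $\alpha\in[0,1]$, $A_\alpha(G)=\alpha D(G)+(1-\alpha)A(G)$; its $A_\alpha$-spectrum is the multiset of its eigenvalues. The power graph $\mathcal P(\mathcal G)$ of a finite group $\mathcal G$ has vertex set $\mathcal G$, two distinct elements $x,y$ being adjacent iff one is a positive power of the other. An elementary abelian $p$-group is an abelian group in which every non-identity element has order $p$. *)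

theory Defs
  imports
    "HOL-Algebra.Multiplicative_Group"
    "Graph_Theory.Pair_Digraph"
    "Jordan_Normal_Form.Char_Poly"
begin

definition elementary_abelian :: "nat \<Rightarrow> ('a, 'b) monoid_scheme \<Rightarrow> bool" where
  "elementary_abelian p G \<longleftrightarrow>
     comm_group G \<and> (\<forall>x \<in> carrier G. x \<noteq> \<one>\<^bsub>G\<^esub> \<longrightarrow> group.ord G x = p)"

text \<open>Finite simple graphs are the symmetric loop-free digraphs of locale \<^locale>\<open>pair_graph\<close>:
  an edge between \<open>x\<close> and \<open>y\<close> is represented by the two arcs \<open>(x, y)\<close> and \<open>(y, x)\<close>.\<close>

definition power_graph :: "('a, 'b) monoid_scheme \<Rightarrow> 'a pair_pre_digraph" where
  "power_graph G =
     \<lparr>pverts = carrier G,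
      parcs = {(x, y). x \<in> carrier G \<and> y \<in> carrier G \<and> x \<noteq> y \<and>
        ((\<exists>k::nat. k > 0 \<and> y = x [^]\<^bsub>G\<^esub> k) \<or> (\<exists>k::nat. k > 0 \<and> x = y [^]\<^bsub>G\<^esub> k))}\<rparr>"

lemma pair_graph_power_graph:
  assumes "finite (carrier G)"
  shows "pair_graph (power_graph G)"
proof
  show "finite (parcs (power_graph G))"
    by (rule finite_subset[of _ "carrier G \<times> carrier G"])
       (use assms in \<open>auto simp: power_graph_def\<close>)
qed (use assms in \<open>auto simp: power_graph_def symmetric_def intro!: symI\<close>)

text \<open>Matrices are indexed by natural numbers, so the matrices of a graph depend on an
  enumeration \<open>vs\<close> of its vertices. In a symmetric digraph the degree of a vertex is its
  out-degree.\<close>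

definition adjacency_mat :: "'a pair_pre_digraph \<Rightarrow> 'a list \<Rightarrow> real mat" where
  "adjacency_mat H vs =
     mat (length vs) (length vs) (\<lambda>(i, j). if (vs ! i, vs ! j) \<in> parcs H then 1 else 0)"

definition degree_mat :: "'a pair_pre_digraph \<Rightarrow> 'a list \<Rightarrow> real mat" where
  "degree_mat H vs =
     mat (length vs) (length vs)
       (\<lambda>(i, j). if i = j then real (out_degree (with_proj H) (vs ! i)) else 0)"

definition A_alpha_mat :: "real \<Rightarrow> 'a pair_pre_digraph \<Rightarrow> 'a list \<Rightarrow> real mat" where
  "A_alpha_mat \<alpha> H vs = \<alpha> \<cdot>\<^sub>m degree_mat H vs + (1 - \<alpha>) \<cdot>\<^sub>m adjacency_mat H vs"

text \<open>Complex eigenvalues with algebraic multiplicity. Over the complex numbers the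
  characteristic polynomial splits, so a square matrix of dimension \<open>n\<close> has exactly \<open>n\<close> of them.\<close>

definition eigenvalue_mset :: "real mat \<Rightarrow> complex multiset" where
  "eigenvalue_mset M = proots (char_poly (map_mat complex_of_real M))"

definition A_alpha_spectrum :: "real \<Rightarrow> 'a pair_pre_digraph \<Rightarrow> 'a list \<Rightarrow> complex multiset" where
  "A_alpha_spectrum \<alpha> H vs = eigenvalue_mset (A_alpha_mat \<alpha> H vs)"

end

(* In an elementary abelian p-group the non-identity elements split into l classes of size p - 1,
   two elements lying in the same class iff they generate the same subgroup. The power graph is
   therefore a cone, with the identity as apex, over l disjoint cliques of size p - 1. The partition
   into these cliques and the identity is equitable, and its quotient matrix is the given
   (l+1) x (l+1) matrix. If the class indicators replace the unit vectors of one representative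
   per class, the matrix becomes block upper triangular; the complementary block has the entries
   a(x,y) - a(rep x, y) for x, y outside the representatives, hence equals (alpha p - 1) times the
   identity of size l (p - 2). *)

theory Submission
  imports Defs
begin

section \<open>Characteristic polynomials: reordering, block triangular form, equitable
  partitions\<close>

lemma det_permute_rows_cols:
  fixes M :: "'a :: comm_ring_1 mat"
  assumes M: "M \<in> carrier_mat n n" and p: "p permutes {0..<n}"
  shows "det (mat n n (\<lambda>(i, j). M $$ (p i, p j))) = det M"
proof -
  have lt: "p i < n" if "i < n" for i
    using permutes_in_image[OF p, of i] that by auto
  \<comment> \<open>Columns are permuted as rows of the transpose. The factor
    \<open>signof p\<close> then occurs twice and squares to 1.\<close>
  define M' where "M' = mat n n (\<lambda>(i, j). transpose_mat M $$ (p i, j))"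
  have M': "M' \<in> carrier_mat n n" by (simp add: M'_def)
  have "det M' = signof p * det M"
    unfolding M'_def using det_permute_rows[OF _ p, of "transpose_mat M"] M det_transpose[OF M] by simp
  moreover have "mat n n (\<lambda>(i, j). M $$ (p i, p j)) = mat n n (\<lambda>(i, j). transpose_mat M' $$ (p i, j))"
    using M lt by (intro eq_matI) (auto simp: M'_def)
  moreover have "det (mat n n (\<lambda>(i, j). transpose_mat M' $$ (p i, j))) = signof p * det M'"
    using det_permute_rows[OF _ p, of "transpose_mat M'"] M' det_transpose[OF M'] by simp
  ultimately show ?thesis
    by (simp add: sign_def)
qed

text \<open>Two enumerations differ by a permutation applied to rows and columns alike, which keeps
  the diagonal of the characteristic matrix on the diagonal. So a given vertex list may be traded
  for one adapted to the classes.\<close>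

lemma char_poly_reorder:
  fixes f :: "'b \<Rightarrow> 'b \<Rightarrow> 'a :: comm_ring_1"
  assumes "distinct xs" "distinct ys" "set xs = set ys"
  shows "char_poly (mat (length xs) (length xs) (\<lambda>(i, j). f (xs ! i) (xs ! j))) =
         char_poly (mat (length ys) (length ys) (\<lambda>(i, j). f (ys ! i) (ys ! j)))"
proof -
  have "mset xs = mset ys"
    using assms set_eq_iff_mset_eq_distinct by blast
  then obtain p where p: "p permutes {..<length ys}" and xs: "permute_list p ys = xs"
    using mset_eq_permutation by metis
  define n where "n = length ys"
  have len: "length xs = n"
    using xs by (auto simp: n_def)
  have p': "p permutes {0..<n}"
    using p by (simp add: n_def lessThan_atLeast0)
  have lt: "p i < n" if "i < n" for i
    using permutes_in_image[OF p', of i] that by auto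
  have nth: "xs ! i = ys ! p i" if "i < n" for i
    using permute_list_nth[OF p, of i] that xs by (simp add: n_def)
  have inj: "p i = p j \<longleftrightarrow> i = j" for i j
    using permutes_inj[OF p'] by (auto dest: injD)
  let ?M = "mat n n (\<lambda>(i, j). f (ys ! i) (ys ! j))"
  have "char_poly_matrix (mat n n (\<lambda>(i, j). f (xs ! i) (xs ! j))) =
        mat n n (\<lambda>(i, j). char_poly_matrix ?M $$ (p i, p j))"
    using lt nth inj by (intro eq_matI) (auto simp: char_poly_matrix_def)
  then show ?thesis
    using det_permute_rows_cols[OF _ p', of "char_poly_matrix ?M"] len
    by (simp add: char_poly_def n_def)
qed

lemma char_poly_block_triangular:
  fixes B :: "'a :: idom mat"
  assumes B: "B \<in> carrier_mat m m" and C: "C \<in> carrier_mat m r" and D: "D \<in> carrier_mat r r"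
  shows "char_poly (four_block_mat B C (0\<^sub>m r m) D) = char_poly B * char_poly D"
proof -
  have "char_poly_matrix (four_block_mat B C (0\<^sub>m r m) D) =
        four_block_mat (char_poly_matrix B) (map_mat (\<lambda>a. [:- a:]) C) (0\<^sub>m r m) (char_poly_matrix D)"
    using assms by (intro eq_matI) (auto simp: char_poly_matrix_def)
  then show ?thesis
    using assms by (simp add: char_poly_def det_four_block_mat_lower_left_zero[where n = m and m = r])
qed

lemma char_poly_scalar:
  "char_poly (a \<cdot>\<^sub>m 1\<^sub>m r :: 'a :: comm_ring_1 mat) = [:- a, 1:] ^ r"
proof -
  have "char_poly (a \<cdot>\<^sub>m 1\<^sub>m r) = (\<Prod>b\<leftarrow>diag_mat (a \<cdot>\<^sub>m 1\<^sub>m r). [:- b, 1:])"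
    by (rule char_poly_upper_triangular[where n = r]) (auto simp: upper_triangular_def)
  also have "diag_mat (a \<cdot>\<^sub>m 1\<^sub>m r) = replicate r a"
    by (auto simp: diag_mat_def list_eq_iff_nth_eq)
  finally show ?thesis
    by simp
qed

text \<open>Here \<open>c i\<close> is the class of index \<open>i\<close>, the first
  \<open>m\<close> indices represent the classes, and \<open>sums\<close> makes \<open>B\<close> the
  quotient matrix. A change of basis to class indicators turns \<open>A\<close> into a block upper
  triangular matrix with \<open>B\<close> in the corner.\<close>

lemma char_poly_equitable_partition:
  fixes A B :: "'a :: idom mat"
  assumes A: "A \<in> carrier_mat N N" and B: "B \<in> carrier_mat m m" and "m \<le> N"
    and c: "\<And>i. i < N \<Longrightarrow> c i < m" and rep: "\<And>i. i < m \<Longrightarrow> c i = i"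
    and sums: "\<And>i k. i < N \<Longrightarrow> k < m \<Longrightarrow> (\<Sum>j | j < N \<and> c j = k. A $$ (i, j)) = B $$ (c i, k)"
  shows "char_poly A = char_poly B *
    char_poly (mat (N - m) (N - m) (\<lambda>(i, j). A $$ (m + i, m + j) - A $$ (c (m + i), m + j)))"
proof -
  define r where "r = N - m"
  have N: "N = m + r"
    using \<open>m \<le> N\<close> by (simp add: r_def)
  define D where "D = mat r r (\<lambda>(i, j). A $$ (m + i, m + j) - A $$ (c (m + i), m + j))"
  define C where "C = mat m r (\<lambda>(i, j). A $$ (i, m + j))"
  \<comment> \<open>\<open>X\<close> records the classes of the non-representatives, so the first
    \<open>m\<close> columns of \<open>P\<close> are the class indicators and the others unit
    vectors. Negating \<open>X\<close> inverts \<open>P\<close>.\<close>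
  define X :: "'a mat" where "X = mat r m (\<lambda>(i, k). if c (m + i) = k then 1 else 0)"
  define U where "U = four_block_mat B C (0\<^sub>m r m) D"
  define P where "P = four_block_mat (1\<^sub>m m) (0\<^sub>m m r) X (1\<^sub>m r)"
  define Q where "Q = four_block_mat (1\<^sub>m m) (0\<^sub>m m r) (- X) (1\<^sub>m r)"
  have X: "X \<in> carrier_mat r m" and C: "C \<in> carrier_mat m r" and D: "D \<in> carrier_mat r r"
    by (auto simp: X_def C_def D_def)
  have carr: "{A, U, P, Q} \<subseteq> carrier_mat N N"
    using A B D by (auto simp: U_def P_def Q_def N)
  have neg: "X + - X = 0\<^sub>m r m" "- X + X = 0\<^sub>m r m" "- 0\<^sub>m m m = (0\<^sub>m m m :: 'a mat)"
    using X by (auto intro!: eq_matI)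
  have "P * Q = four_block_mat (1\<^sub>m m) (0\<^sub>m m r) (0\<^sub>m r m) (1\<^sub>m r)"
    unfolding P_def Q_def using X
    by (subst mult_four_block_mat[OF one_carrier_mat zero_carrier_mat X one_carrier_mat
          one_carrier_mat zero_carrier_mat _ one_carrier_mat]) (auto simp: neg)
  moreover have "Q * P = four_block_mat (1\<^sub>m m) (0\<^sub>m m r) (0\<^sub>m r m) (1\<^sub>m r)"
    unfolding P_def Q_def using X
    by (subst mult_four_block_mat[OF one_carrier_mat zero_carrier_mat _ one_carrier_mat
          one_carrier_mat zero_carrier_mat X one_carrier_mat]) (auto simp: neg)
  ultimately have PQ: "P * Q = 1\<^sub>m N" "Q * P = 1\<^sub>m N"
    by (simp_all add: N)
  have Pcol: "P $$ (k, j) = (if j < m then (if c k = j then 1 else 0) else (if k = j then 1 else 0))"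
    if "k < N" "j < N" for k j
    using that rep X by (auto simp: P_def N X_def)
  \<comment> \<open>\<open>P\<close> is read by columns in \<open>A * P\<close> and by rows in
    \<open>P * U\<close>. The case \<open>i < m\<close> keeps a representative, where
    \<open>c i = i\<close>, from being counted twice.\<close>
  have Prow: "P $$ (i, k) = (if i < m then 0 else if k = c i then 1 else 0) + (if k = i then 1 else 0)"
    if "i < N" "k < N" for i k
    using that rep c[of i] X by (auto simp: P_def N X_def)
  have Uval: "U $$ (k, j) =
      (if k < m then (if j < m then B $$ (k, j) else A $$ (k, j))
       else (if j < m then 0 else A $$ (k, j) - A $$ (c k, j)))"
    if "k < N" "j < N" for k j
    using that B C D by (auto simp: U_def C_def D_def N)
  have "A * P = P * U"
  proof (rule eq_matI)
    fix i j assume "i < dim_row (P * U)" "j < dim_col (P * U)"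
    then have ij: "i < N" "j < N" using carr by auto
    have "(A * P) $$ (i, j) = (\<Sum>k = 0..<N. A $$ (i, k) * P $$ (k, j))"
      using carr ij by (auto simp: scalar_prod_def)
    also have "\<dots> = (if j < m then B $$ (c i, j) else A $$ (i, j))"
    proof (cases "j < m")
      case True
      have "(\<Sum>k = 0..<N. A $$ (i, k) * P $$ (k, j)) = (\<Sum>k = 0..<N. if c k = j then A $$ (i, k) else 0)"
        using True ij by (intro sum.cong) (auto simp: Pcol)
      also have "\<dots> = (\<Sum>k | k < N \<and> c k = j. A $$ (i, k))"
        by (subst sum.inter_filter [symmetric]) (auto intro: sum.cong)
      finally show ?thesis using sums[OF ij(1) True] True by simp
    next
      case False
      have "(\<Sum>k = 0..<N. A $$ (i, k) * P $$ (k, j)) = (\<Sum>k = 0..<N. if k = j then A $$ (i, k) else 0)"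
        using False ij by (intro sum.cong) (auto simp: Pcol)
      then show ?thesis using False ij by simp
    qed
    \<comment> \<open>For a non-representative \<open>i\<close>, row \<open>c i\<close> of
      \<open>U\<close> restores what was missing from row \<open>i\<close>:
      \<open>B $$ (c i, j)\<close> on the left, the subtracted \<open>A $$ (c i, j)\<close> on the
      right.\<close>
    also have "\<dots> = (if i < m then 0 else U $$ (c i, j)) + U $$ (i, j)"
      using ij c[of i] rep \<open>m \<le> N\<close> by (auto simp: Uval)
    also have "\<dots> = (\<Sum>k = 0..<N. (if i < m then 0 else if k = c i then U $$ (k, j) else 0)
        + (if k = i then U $$ (k, j) else 0))"
      using ij c[of i] \<open>m \<le> N\<close> by (auto simp: sum.distrib)
    also have "\<dots> = (\<Sum>k = 0..<N. P $$ (i, k) * U $$ (k, j))"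
      using ij by (intro sum.cong) (auto simp: Prow distrib_right)
    also have "\<dots> = (P * U) $$ (i, j)"
      using carr ij by (auto simp: scalar_prod_def)
    finally show "(A * P) $$ (i, j) = (P * U) $$ (i, j)" .
  qed (use carr in auto)
  then have "A * (P * Q) = P * U * Q"
    using carr by (simp flip: assoc_mult_mat[where ?n\<^sub>1 = N and ?n\<^sub>2 = N and ?n\<^sub>3 = N and ?n\<^sub>4 = N])
  then have "similar_mat A U"
    using carr PQ A by (intro similar_matI[where P = P and Q = Q and n = N]) auto
  then have "char_poly A = char_poly U"
    by (rule char_poly_similar)
  then show ?thesis
    using char_poly_block_triangular[OF B C D] by (simp add: U_def D_def r_def)
qed

text \<open>Lists \<open>a\<close>, then one element of every other fibre of \<open>h\<close>, then
  the rest; this is the order that the representatives in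
  \<open>char_poly_equitable_partition\<close> require.\<close>

lemma enumeration_transversal_first:
  assumes "finite S" "a \<in> S"
  obtains ws where "distinct ws" "set ws = S" "ws ! 0 = a"
    "bij_betw (\<lambda>i. h (ws ! i)) {..<card (h ` S)} (h ` S)"
proof -
  \<comment> \<open>The label \<open>h a\<close> is left out because \<open>a\<close> itself
    represents it.\<close>
  define R where "R = inv_into S h ` (h ` S - {h a})"
  have R: "R \<subseteq> S" "h ` R = h ` S - {h a}" "inj_on h R"
    by (auto simp: R_def inv_into_into f_inv_into_f inj_on_def image_image)
  then have "finite R" "a \<notin> R"
    using assms finite_subset by auto
  obtain us where us: "set us = R" "distinct us"
    using finite_distinct_list[OF \<open>finite R\<close>] by blast
  obtain ts where ts: "set ts = S - insert a R" "distinct ts"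
    using finite_distinct_list[of "S - insert a R"] assms by blast
  define xs where "xs = a # us"
  have xs: "distinct xs" "set xs = insert a R"
    using us \<open>a \<notin> R\<close> by (auto simp: xs_def)
  have "bij_betw h (insert a R) (h ` S)"
    using R assms by (auto simp: bij_betw_def)
  then have bij: "bij_betw (\<lambda>i. h (xs ! i)) {..<length xs} (h ` S)"
    using bij_betw_trans[OF bij_betw_nth[OF xs(1) refl xs(2)[symmetric]]] by (simp add: o_def)
  then have len: "card (h ` S) = length xs"
    using bij_betw_same_card by fastforce
  show thesis
  proof
    show "distinct (xs @ ts)" "set (xs @ ts) = S" "(xs @ ts) ! 0 = a"
      using xs ts R assms by (auto simp: xs_def)
    show "bij_betw (\<lambda>i. h ((xs @ ts) ! i)) {..<card (h ` S)} (h ` S)"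
      using bij by (subst bij_betw_cong[where g = "\<lambda>i. h (xs ! i)"]) (auto simp: len nth_append)
  qed
qed

section \<open>Cyclic subgroups of an elementary abelian group and its power graph\<close>

lemma (in group) generate_eq_if_prime_ord:
  assumes "prime (ord x)" "x \<in> carrier G" "y \<in> generate G {x}" "y \<noteq> \<one>"
  shows "generate G {y} = generate G {x}"
proof -
  have y: "y \<in> carrier G"
    using assms generate_in_carrier[of "{x}" y] by auto
  have sub: "generate G {y} \<subseteq> generate G {x}"
    using assms generate_subgroup_incl[OF _ generate_is_subgroup[of "{x}"]] by auto
  \<comment> \<open>Order 0 would mean infinite order; excluding it makes
    \<open>generate G {x}\<close> finite without a finiteness assumption on the group.\<close>
  have ord_pos: "ord x \<noteq> 0"
    using assms(1) by (auto intro: notI)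
  have fin: "finite (generate G {x})"
    using ord_pos unfolding generate_pow_card[OF \<open>x \<in> carrier G\<close>] by (auto intro: card_ge_0_finite)
  obtain k :: nat where k: "y = x [^] k"
    using assms(3) unfolding generate_pow_nat[OF \<open>x \<in> carrier G\<close> ord_pos] by blast
  then have "y [^] ord x = \<one>"
    using nat_pow_pow[OF assms(2), of k "ord x"] nat_pow_pow[OF assms(2), of "ord x" k]
    by (simp add: k assms(2) mult.commute)
  then have "ord y dvd ord x"
    using y pow_eq_id by blast
  moreover have "ord y \<noteq> 1"
    using assms y ord_eq_1 by blast
  ultimately have "ord y = ord x"
    using assms(1) prime_nat_iff by blast
  then have "card (generate G {y}) = card (generate G {x})"
    by (simp only: generate_pow_card[OF y] generate_pow_card[OF assms(2)])
  then show ?thesis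
    using sub fin card_subset_eq by blast
qed

context
  fixes G (structure) and p :: nat
  assumes elem: "elementary_abelian p G" and p: "prime p" and fin: "finite (carrier G)"
begin

interpretation comm_group G
  using elem by (simp add: elementary_abelian_def)

lemma ord_eq_p: "x \<in> carrier G \<Longrightarrow> x \<noteq> \<one> \<Longrightarrow> ord x = p"
  using elem by (simp add: elementary_abelian_def)

text \<open>A subgroup of prime order is generated by each of its non-identity elements, and the
  identity generates only the trivial subgroup.\<close>

lemma generate_eq_iff:
  assumes "x \<in> carrier G" "x \<noteq> \<one>" "y \<in> carrier G"
  shows "generate G {y} = generate G {x} \<longleftrightarrow> y \<in> generate G {x} - {\<one>}"
proof
  assume eq: "generate G {y} = generate G {x}"
  then have "y \<in> generate G {x}"
    using generate.incl[of y "{y}" G] by auto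
  moreover have "y \<noteq> \<one>"
  proof
    assume "y = \<one>"
    then have "x \<in> {\<one>}"
      using eq generate_one generate.incl[of x "{x}" G] by auto
    then show False using assms by simp
  qed
  ultimately show "y \<in> generate G {x} - {\<one>}" by simp
qed (use assms generate_eq_if_prime_ord ord_eq_p p in auto)

lemma generator_class:
  assumes "x \<in> carrier G" "x \<noteq> \<one>"
  shows "{y \<in> carrier G. generate G {y} = generate G {x}} = generate G {x} - {\<one>}"
  using assms generate_eq_iff generate_in_carrier[of "{x}"] by auto

lemma card_generator_class:
  assumes "x \<in> carrier G" "x \<noteq> \<one>"
  shows "card {y \<in> carrier G. generate G {y} = generate G {x}} = p - 1"
  using assms generator_class generate_pow_card[of x] ord_eq_p generate.one[of G "{x}"] by simp

lemma generator_class_one: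
  "{y \<in> carrier G. generate G {y} = generate G {\<one>}} = {\<one>}"
proof -
  \<comment> \<open>\<open>generate_eq_iff\<close> is used with \<open>y\<close> as the generator:
    if \<open>y\<close> were not the identity, the identity would lie in a set that excludes
    it.\<close>
  have "y = \<one>" if "y \<in> carrier G" "generate G {y} = generate G {\<one>}" for y
    using that generate_eq_iff[of y \<one>] by auto
  then show ?thesis by auto
qed

text \<open>The identity is the \<open>p\<close>-th power of every element, hence the apex of the
  cone; between other elements adjacency means generating the same subgroup.\<close>

lemma power_graph_arc_iff:
  assumes "x \<in> carrier G" "y \<in> carrier G"
  shows "(x, y) \<in> parcs (power_graph G) \<longleftrightarrow>
    x \<noteq> y \<and> (x = \<one> \<or> y = \<one> \<or> generate G {y} = generate G {x})"
proof -
  have pow: "(\<exists>k::nat. k > 0 \<and> b = a [^] k) \<longleftrightarrow> b = \<one> \<or> generate G {b} = generate G {a}"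
    if ab: "a \<in> carrier G" "b \<in> carrier G" "a \<noteq> b" for a b
  proof (cases "b = \<one>")
    case True
    then show ?thesis
      using ab ord_eq_p[of a] pow_ord_eq_1[of a] p prime_gt_0_nat by metis
  next
    case b: False
    show ?thesis
    proof (cases "a = \<one>")
      case True
      then show ?thesis using b ab generator_class_one by auto
    next
      case False
      \<comment> \<open>The generated subgroup also admits exponent 0, but that yields the identity,
        which \<open>b\<close> is not.\<close>
      have "(\<exists>k::nat. k > 0 \<and> b = a [^] k) \<longleftrightarrow> b \<in> generate G {a}"
        unfolding generate_pow_on_finite_carrier[OF fin ab(1)] using b
        by auto (metis gr0I nat_pow_0)
      then show ?thesis using generate_eq_iff[OF ab(1) False ab(2)] b by auto
    qed
  qed
  show ?thesis
    using pow[of x y] pow[of y x] assms by (auto simp: power_graph_def)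
qed

lemma degree_power_graph:
  assumes "x \<in> carrier G"
  shows "out_degree (with_proj (power_graph G)) x = (if x = \<one> then card (carrier G) - 1 else p - 1)"
proof -
  have arc_carrier: "y \<in> carrier G" if "(x, y) \<in> parcs (power_graph G)" for y
    using that by (simp add: power_graph_def)
  have "out_arcs (with_proj (power_graph G)) x = Pair x ` {y \<in> carrier G. (x, y) \<in> parcs (power_graph G)}"
    using arc_carrier by (auto simp: out_arcs_def)
  then have *: "out_degree (with_proj (power_graph G)) x = card {y \<in> carrier G. (x, y) \<in> parcs (power_graph G)}"
    by (simp add: out_degree_def card_image inj_on_def)
  show ?thesis
  proof (cases "x = \<one>")
    case True
    then have "{y \<in> carrier G. (x, y) \<in> parcs (power_graph G)} = carrier G - {\<one>}"
      using power_graph_arc_iff by auto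
    then show ?thesis using * True by simp
  next
    case False
    \<comment> \<open>The neighbours are the \<open>p - 2\<close> other generators together with the
      identity, that is, all of the subgroup except \<open>x\<close>.\<close>
    have "{y \<in> carrier G. (x, y) \<in> parcs (power_graph G)} = generate G {x} - {x}"
      using False assms power_graph_arc_iff[OF assms] generate_eq_iff[OF assms False]
        generate_in_carrier[of "{x}"] generate.one[of G "{x}"] by auto
    then show ?thesis
      using * False assms generate_pow_card[OF assms] ord_eq_p generate.incl[of x "{x}" G] by simp
  qed
qed

text \<open>The non-identity elements are counted by the subgroup they generate, each subgroup
  having \<open>p - 1\<close> generators.\<close>

lemma card_cyclic_subgroups:
  "card (carrier G) = card ((\<lambda>x. generate G {x}) ` (carrier G - {\<one>})) * (p - 1) + 1"
proof -
  let ?S = "carrier G - {\<one>}" and ?H = "\<lambda>x. generate G {x}"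
  have "{y \<in> ?S. ?H y = ?H x} = {y \<in> carrier G. ?H y = ?H x}" if "x \<in> ?S" for x
    using that generate_eq_iff by auto
  then have "card {y \<in> ?S. ?H y = ?H x} = p - 1" if "x \<in> ?S" for x
    using that card_generator_class[of x] by simp
  then have "card {y \<in> ?S. ?H y = K} = p - 1" if "K \<in> ?H ` ?S" for K
    using that by blast
  then have "card ?S = card (?H ` ?S) * (p - 1)"
    using sum.group[of ?S "?H ` ?S" ?H "\<lambda>_. 1 :: nat"] fin by simp
  moreover have "card (carrier G) = card ?S + 1"
    using fin card.remove[of "carrier G" \<one>] by simp
  ultimately show ?thesis by (simp only:)
qed

text \<open>Only the identity generates the trivial subgroup, which accounts for the one extra
  class.\<close>

lemma card_generator_classes:
  "card ((\<lambda>x. generate G {x}) ` carrier G) = card ((\<lambda>x. generate G {x}) ` (carrier G - {\<one>})) + 1"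
proof -
  let ?H = "\<lambda>x. generate G {x}"
  have "?H \<one> \<notin> ?H ` (carrier G - {\<one>})"
    using generator_class_one by blast
  moreover have "?H ` carrier G = insert (?H \<one>) (?H ` (carrier G - {\<one>}))"
    by auto
  ultimately show ?thesis
    using fin by simp
qed

section \<open>The matrix of the power graph, its class sums and its characteristic
  polynomial\<close>

definition A_alpha_entry :: "real \<Rightarrow> 'a \<Rightarrow> 'a \<Rightarrow> real" where
  "A_alpha_entry \<alpha> x y =
    (if x = y then \<alpha> * (if x = \<one> then real (card (carrier G)) - 1 else real p - 1)
     else if x = \<one> \<or> y = \<one> \<or> generate G {y} = generate G {x} then 1 - \<alpha> else 0)"

text \<open>Expressing the entries through group elements instead of positions makes
  \<open>char_poly_reorder\<close> applicable.\<close>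

lemma A_alpha_mat_power_graph:
  assumes "distinct xs" "set xs = carrier G"
  shows "A_alpha_mat \<alpha> (power_graph G) xs =
    mat (length xs) (length xs) (\<lambda>(i, j). A_alpha_entry \<alpha> (xs ! i) (xs ! j))"
proof -
  \<comment> \<open>Both lower bounds let the truncated subtractions in the degrees pass to real
    ones.\<close>
  have "card (carrier G) \<ge> 1"
    using card_cyclic_subgroups by simp
  moreover have "p \<ge> 1"
    using p prime_ge_1_nat by blast
  ultimately show ?thesis
    using assms nth_mem[of _ xs]
    by (intro eq_matI)
      (auto simp: A_alpha_mat_def degree_mat_def adjacency_mat_def A_alpha_entry_def
        nth_eq_iff_index_eq degree_power_graph power_graph_arc_iff of_nat_diff)
qed

text \<open>This is equitability: the sum depends on \<open>x\<close> only through its class, and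
  its values are the entries of the quotient matrix.\<close>

lemma A_alpha_entry_class_sum:
  assumes x: "x \<in> carrier G" and z: "z \<in> carrier G"
  shows "(\<Sum>y | y \<in> carrier G \<and> generate G {y} = generate G {z}. A_alpha_entry \<alpha> x y) =
    (if x = \<one> \<and> z = \<one> then \<alpha> * (real (card (carrier G)) - 1)
     else if x = \<one> then (1 - \<alpha>) * (real p - 1)
     else if z = \<one> then 1 - \<alpha>
     else if generate G {x} = generate G {z} then \<alpha> + real p - 2
     else 0)"
proof (cases "z = \<one>")
  case True
  then show ?thesis
    using generator_class_one by (simp add: A_alpha_entry_def)
next
  case False
  define K where "K = {y \<in> carrier G. generate G {y} = generate G {z}}"
  have card_K: "card K = p - 1"
    using card_generator_class[OF z False] by (simp add: K_def)
  have "p \<ge> 2"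
    using p prime_ge_2_nat by blast
  have "finite K"
    using fin by (simp add: K_def)
  have "\<one> \<notin> K"
    using generate_eq_iff[OF z False, of \<one>] by (auto simp: K_def)
  have "sum (A_alpha_entry \<alpha> x) K =
    (if x = \<one> then (1 - \<alpha>) * (real p - 1) else if x \<in> K then \<alpha> + real p - 2 else 0)"
  proof (cases "x \<in> K")
    case True
    then have "x \<noteq> \<one>"
      using \<open>\<one> \<notin> K\<close> by blast
    \<comment> \<open>Within its own class \<open>x\<close> has \<open>p - 2\<close> neighbours; the
      diagonal term is added afterwards.\<close>
    have "sum (A_alpha_entry \<alpha> x) (K - {x}) = (\<Sum>y\<in>K - {x}. 1 - \<alpha>)"
      using True by (intro sum.cong) (auto simp: A_alpha_entry_def K_def)
    also have "\<dots> = real (p - 2) * (1 - \<alpha>)"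
      using True \<open>finite K\<close> card_K by (simp add: numeral_2_eq_2)
    finally have "sum (A_alpha_entry \<alpha> x) K = \<alpha> * (real p - 1) + real (p - 2) * (1 - \<alpha>)"
      using True \<open>x \<noteq> \<one>\<close> \<open>finite K\<close> by (simp add: sum.remove A_alpha_entry_def)
    then show ?thesis
      using True \<open>x \<noteq> \<one>\<close> \<open>p \<ge> 2\<close> by (simp add: of_nat_diff algebra_simps)
  next
    case False
    \<comment> \<open>From outside \<open>K\<close>, only the identity is adjacent to elements of
      \<open>K\<close>, and then to all \<open>p - 1\<close> of them.\<close>
    have "sum (A_alpha_entry \<alpha> x) K = (\<Sum>y\<in>K. if x = \<one> then 1 - \<alpha> else 0)"
      using False x \<open>\<one> \<notin> K\<close> by (intro sum.cong) (auto simp: A_alpha_entry_def K_def)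
    then show ?thesis
      using False \<open>p \<ge> 2\<close> card_K by (simp add: of_nat_diff)
  qed
  then show ?thesis
    using False x by (simp add: K_def)
qed

text \<open>The equitable partition result is applied to an enumeration starting with the identity
  and one generator of each subgroup of order \<open>p\<close>. The number \<open>l\<close> enters
  through a product, so no division is involved.\<close>

lemma char_poly_A_alpha_power_graph:
  assumes l: "card (carrier G) = l * (p - 1) + 1" and vs: "distinct vs" "set vs = carrier G"
  shows "char_poly (A_alpha_mat \<alpha> (power_graph G) vs) =
    char_poly (mat (l + 1) (l + 1) (\<lambda>(i, j).
      if i = 0 \<and> j = 0 then \<alpha> * real l * (real p - 1)
      else if i = 0 then (1 - \<alpha>) * (real p - 1)
      else if j = 0 then 1 - \<alpha>
      else if i = j then \<alpha> + real p - 2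
      else 0)) * [:- (\<alpha> * real p - 1), 1:] ^ (l * (p - 2))"
    (is "_ = char_poly ?B * _")
proof -
  define H where "H x = generate G {x}" for x
  define N where "N = card (carrier G)"
  have "p \<ge> 2"
    using p prime_ge_2_nat by blast
  then have l_eq: "card ((\<lambda>x. generate G {x}) ` (carrier G - {\<one>})) = l"
    using l card_cyclic_subgroups by simp
  have card_H: "card (H ` carrier G) = l + 1"
    using card_generator_classes l_eq by (simp add: H_def[abs_def])
  obtain ws where ws: "distinct ws" "set ws = carrier G" "ws ! 0 = \<one>"
    and bij: "bij_betw (\<lambda>i. H (ws ! i)) {..<l + 1} (H ` carrier G)"
    using enumeration_transversal_first[OF fin one_closed, of H] card_H by metis
  have len: "length ws = N"
    using distinct_card[OF ws(1)] ws(2) by (simp add: N_def)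
  \<comment> \<open>Each of the \<open>l\<close> classes leaves \<open>p - 2\<close> elements
    besides its representative; for \<open>p = 2\<close> the complementary block is empty.\<close>
  have N: "N = l + 1 + l * (p - 2)"
  proof -
    have "p - 1 = Suc (p - 2)" using \<open>p \<ge> 2\<close> by simp
    then show ?thesis using l by (simp add: N_def)
  qed
  have nth_in: "ws ! i \<in> carrier G" if "i < N" for i
    using that ws len nth_mem by blast
  have carrier_nth: "carrier G = (!) ws ` {..<N}"
    using ws(2) len by (auto simp: set_conv_nth)
  have nth_eq: "ws ! i = ws ! j \<longleftrightarrow> i = j" if "i < N" "j < N" for i j
    using that ws len nth_eq_iff_index_eq by blast
  have nth_one: "ws ! i = \<one> \<longleftrightarrow> i = 0" if "i < N" for i
    using nth_eq[OF that, of 0] ws(3) that by simp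
  \<comment> \<open>\<open>c i\<close> is the position, among the first \<open>l + 1\<close>, of the
    representative generating the same subgroup as \<open>ws ! i\<close>.\<close>
  define c where "c i = inv_into {..<l + 1} (\<lambda>i. H (ws ! i)) (H (ws ! i))" for i
  have c: "c i < l + 1" "H (ws ! c i) = H (ws ! i)" if "i < N" for i
  proof -
    have "H (ws ! i) \<in> (\<lambda>i. H (ws ! i)) ` {..<l + 1}"
      using bij nth_in[OF that] by (simp add: bij_betw_def)
    from inv_into_into[OF this] f_inv_into_f[OF this]
    show "c i < l + 1" "H (ws ! c i) = H (ws ! i)"
      by (simp_all add: c_def)
  qed
  have c_eq: "c i = k \<longleftrightarrow> H (ws ! i) = H (ws ! k)" if "i < N" "k < l + 1" for i k
    using c[OF that(1)] that(2) bij_betw_imp_inj_on[OF bij] by (auto simp: inj_on_def)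
  have c_rep: "c k = k" if "k < l + 1" for k
    using c_eq[of k k] that N by simp
  \<comment> \<open>Position 0 forms a class by itself, so row and column 0 of the quotient matrix
    belong to the identity alone.\<close>
  have c_zero: "c i = 0 \<longleftrightarrow> i = 0" if "i < N" for i
  proof -
    have "c i = 0 \<longleftrightarrow> ws ! i \<in> {y \<in> carrier G. generate G {y} = generate G {\<one>}}"
      using c_eq[OF that, of 0] nth_in[OF that] ws(3) by (simp add: H_def)
    then show ?thesis
      using nth_one[OF that] generator_class_one by simp
  qed
  define A where "A = mat N N (\<lambda>(i, j). A_alpha_entry \<alpha> (ws ! i) (ws ! j))"
  have real_N: "real N - 1 = real l * (real p - 1)"
    using l \<open>p \<ge> 2\<close> by (simp add: N_def of_nat_diff)
  have sums: "(\<Sum>j | j < N \<and> c j = k. A $$ (i, j)) = ?B $$ (c i, k)"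
    if i: "i < N" and k: "k < l + 1" for i k
  proof -
    have kN: "k < N" using k N by simp
    have "bij_betw ((!) ws) {j. j < N \<and> c j = k} {y \<in> carrier G. H y = H (ws ! k)}"
      unfolding bij_betw_def
    proof
      show "inj_on ((!) ws) {j. j < N \<and> c j = k}"
        using nth_eq by (auto simp: inj_on_def)
      show "(!) ws ` {j. j < N \<and> c j = k} = {y \<in> carrier G. H y = H (ws ! k)}"
        using c_eq[OF _ k] by (auto simp: carrier_nth)
    qed
    then have "(\<Sum>j | j < N \<and> c j = k. A_alpha_entry \<alpha> (ws ! i) (ws ! j)) =
      (\<Sum>y | y \<in> carrier G \<and> H y = H (ws ! k). A_alpha_entry \<alpha> (ws ! i) y)"
      by (rule sum.reindex_bij_betw)
    moreover have "(\<Sum>j | j < N \<and> c j = k. A $$ (i, j)) =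
      (\<Sum>j | j < N \<and> c j = k. A_alpha_entry \<alpha> (ws ! i) (ws ! j))"
      using i by (intro sum.cong) (auto simp: A_def)
    ultimately show ?thesis
      using A_alpha_entry_class_sum[OF nth_in[OF i] nth_in[OF kN], of \<alpha>] real_N
        nth_one[OF i] nth_one[OF kN] c_eq[OF i k] c(1)[OF i] c_zero[OF i] k
      by (auto simp: H_def N_def)
  qed
  have D: "mat (N - (l + 1)) (N - (l + 1))
      (\<lambda>(i, j). A $$ (l + 1 + i, l + 1 + j) - A $$ (c (l + 1 + i), l + 1 + j)) =
    (\<alpha> * real p - 1) \<cdot>\<^sub>m 1\<^sub>m (l * (p - 2))"
  proof (rule eq_matI)
    fix i j
    assume "i < dim_row ((\<alpha> * real p - 1) \<cdot>\<^sub>m 1\<^sub>m (l * (p - 2)))"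
      and "j < dim_col ((\<alpha> * real p - 1) \<cdot>\<^sub>m 1\<^sub>m (l * (p - 2)))"
    then have ij: "i < l * (p - 2)" "j < l * (p - 2)" by auto
    let ?i = "l + 1 + i" and ?j = "l + 1 + j"
    have lt: "?i < N" "?j < N" "c ?i < N"
      using ij N c(1)[of ?i] by auto
    \<comment> \<open>Since \<open>c ?i < l + 1 \<le> ?j\<close>, the representative never equals
      the column element. On the diagonal the difference is
      \<open>\<alpha> * (p - 1) - (1 - \<alpha>)\<close>; elsewhere the two rows agree, both
      elements having the same class.\<close>
    have "ws ! ?i \<noteq> \<one>" "ws ! ?j \<noteq> \<one>" "ws ! c ?i \<noteq> \<one>" "ws ! c ?i \<noteq> ws ! ?j"
      using lt nth_one c_zero[of ?i] nth_eq c(1)[OF lt(1)] by auto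
    moreover have "generate G {ws ! c ?i} = generate G {ws ! ?i}"
      using c(2)[OF lt(1)] by (simp add: H_def)
    moreover have "ws ! ?i = ws ! ?j \<longleftrightarrow> i = j"
      using nth_eq lt by simp
    ultimately have "A_alpha_entry \<alpha> (ws ! ?i) (ws ! ?j) - A_alpha_entry \<alpha> (ws ! c ?i) (ws ! ?j) =
        (if i = j then \<alpha> * real p - 1 else 0)"
      by (auto simp: A_alpha_entry_def algebra_simps)
    then show "mat (N - (l + 1)) (N - (l + 1))
        (\<lambda>(i, j). A $$ (l + 1 + i, l + 1 + j) - A $$ (c (l + 1 + i), l + 1 + j)) $$ (i, j) =
      ((\<alpha> * real p - 1) \<cdot>\<^sub>m 1\<^sub>m (l * (p - 2))) $$ (i, j)"
      using ij lt N by (simp add: A_def)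
  qed (use N in auto)
  have "char_poly (A_alpha_mat \<alpha> (power_graph G) vs) = char_poly A"
    using char_poly_reorder[of vs ws "A_alpha_entry \<alpha>"] A_alpha_mat_power_graph[OF vs] vs ws len
    by (simp add: A_def)
  also have "\<dots> = char_poly ?B * char_poly ((\<alpha> * real p - 1) \<cdot>\<^sub>m 1\<^sub>m (l * (p - 2)))"
    unfolding D[symmetric]
    by (rule char_poly_equitable_partition) (use N c(1) c_rep sums in \<open>auto simp: A_def\<close>)
  finally show ?thesis
    by (simp only: char_poly_scalar)
qed

end

section \<open>From characteristic polynomials to multisets of complex eigenvalues\<close>

lemma eigenvalue_mset_conv_proots:
  assumes "M \<in> carrier_mat n n"
  shows "eigenvalue_mset M = proots (map_poly complex_of_real (char_poly M))"
  by (simp add: eigenvalue_mset_def of_real_hom.char_poly_hom[OF assms])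

text \<open>The embedding of the reals into the complex numbers preserves the factorization, and the
  root multiset of a product of nonzero polynomials is the sum of those of its factors.\<close>

lemma eigenvalue_mset_eqI:
  assumes M: "M \<in> carrier_mat n n" and B: "B \<in> carrier_mat m m"
    and eq: "char_poly M = char_poly B * [:- a, 1:] ^ k"
  shows "eigenvalue_mset M = replicate_mset k (complex_of_real a) + eigenvalue_mset B"
proof -
  interpret map_poly_comm_ring_hom complex_of_real ..
  have "monic (char_poly B)"
    using degree_monic_char_poly[OF B] by simp
  then have nz: "map_poly complex_of_real (char_poly B) \<noteq> 0"
    by auto
  have "map_poly complex_of_real (char_poly M) =
      map_poly complex_of_real (char_poly B) * [:- complex_of_real a, 1:] ^ k"
    by (simp add: eq hom_distribs)
  then show ?thesis
    using nz by (simp add: eigenvalue_mset_conv_proots[OF M] eigenvalue_mset_conv_proots[OF B]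
        proots_mult proots_power)
qed

theorem theorem3p11:
  fixes \<alpha> :: real and p n l :: nat and G :: "('a, 'b) monoid_scheme" and vs :: "'a list"
  assumes "0 \<le> \<alpha>" and "\<alpha> \<le> 1"
    and "prime p" and "n > 0"
    and "elementary_abelian p G" and "Coset.order G = p ^ n"
    and "l = (p ^ n - 1) div (p - 1)"
    and "distinct vs" and "set vs = pverts (power_graph G)"
  shows "A_alpha_spectrum \<alpha> (power_graph G) vs =
    replicate_mset (l * (p - 2)) (complex_of_real (\<alpha> * real p - 1)) +
    eigenvalue_mset (mat (l + 1) (l + 1) (\<lambda>(i, j).
      if i = 0 \<and> j = 0 then \<alpha> * real l * (real p - 1)
      else if i = 0 then (1 - \<alpha>) * (real p - 1)
      else if j = 0 then 1 - \<alpha>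
      else if i = j then \<alpha> + real p - 2
      else 0))"
proof -
  interpret comm_group G
    using assms(5) by (simp add: elementary_abelian_def)
  have fin: "finite (carrier G)"
    using assms(3,6) order_gt_0_iff_finite prime_gt_0_nat by simp
  note elem = assms(5) assms(3) fin
  have "p \<ge> 2"
    using assms(3) prime_ge_2_nat by blast
  have card_eq: "card (carrier G) = card ((\<lambda>x. generate G {x}) ` (carrier G - {\<one>\<^bsub>G\<^esub>})) * (p - 1) + 1"
    by (rule card_cyclic_subgroups[OF elem])
  \<comment> \<open>By the count of cyclic subgroups this quotient is exact, and its divisor is
    positive as \<open>p \<ge> 2\<close>; so \<open>l\<close> is the number of subgroups of order
    \<open>p\<close>.\<close>
  have "l = (card (carrier G) - 1) div (p - 1)"
    using assms(6,7) by (simp add: Coset.order_def)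
  then have "l = card ((\<lambda>x. generate G {x}) ` (carrier G - {\<one>\<^bsub>G\<^esub>}))"
    using card_eq \<open>p \<ge> 2\<close> by simp
  with card_eq have "card (carrier G) = l * (p - 1) + 1"
    by (simp only:)
  moreover have "set vs = carrier G"
    using assms(9) by (simp add: power_graph_def)
  ultimately show ?thesis
    unfolding A_alpha_spectrum_def
    by (intro eigenvalue_mset_eqI[where n = "length vs" and m = "l + 1"]
        char_poly_A_alpha_power_graph[OF elem] assms(8))
      (auto simp: A_alpha_mat_def degree_mat_def adjacency_mat_def)
qed

end
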